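(* Let $\mathcal{H}$ be a real Hilbert space, $\eta\colon\mathcal{H}\to\mathbb{R}$ a smooth convex function, and $f\colon[0,T]\times\mathcal{H}\to\mathcal{H}$ smooth. Let a Runge--Kutta method with coefficients $A=(a_{ij})\in\mathbb{R}^{s\times s}$, $b,c\in\mathbb{R}^s$ satisfy $$\sum_{i,j=1}^s b_ia_{ij}>0\qquad\text{and}\qquad\sum_{i,j=1}^s b_i(a_{ij}-b_j)<0$$ (both conditions hold for every Runge--Kutta method that is at least second order accurate). Fix $t_n\in[0,T)$ and $u^n\in\mathcal{H}$, and let $f_0=f(t_n,u^n)$. For a step size $\Delta t>0$ let $r$ be the function $$r(\gamma)=\eta\Bigl(u^n+\gamma\Delta t\sum_{i=1}^s b_if_i\Bigr)-\eta(u^n)-\gamma\Delta t\sum_{i=1}^s b_i\langle\eta'(y_i),f_i\rangle ,$$ where $y_i$ are the stage values of the method and $f_i=f(t_n+c_i\Delta t,y_i)$. If $\eta''(u^n)(f_0,f_0)>0$, then for all sufficiently small $\Delta t>0$ the function $r$ has a positive root.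
   Context: Stage values: $y_i=u^n+\Delta t\sum_{j=1}^s a_{ij}f(t_n+c_j\Delta t,y_j)$, $i=1,\dots,s$. It is assumed that $A\mathbf{1}=c$ with $\mathbf{1}=(1,\dots,1)^T$. For implicit methods, $y_i=y_i(\Delta t)$ denotes the solution branch with $y_i\to u^n$ as $\Delta t\to0$ (unique for small $\Delta t$). Only step sizes with all stage times $t_n+c_i\Delta t\in[0,T]$ are considered. $\eta'(u)$ is the gradient of $\eta$ at $u$ and $\eta''(u)(\cdot,\cdot)$ its second derivative as a bilinear form. *)

theory Defs
  imports "HOL-Analysis.Analysis"
begin

text \<open>
  Infinitely often Frechet differentiable maps between normed spaces, relative to a set \<open>S\<close>
  (so that one-sided derivatives are taken at boundary points of \<open>S\<close>).  Since the \<open>k\<close>-th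
  derivative lives in a type depending on \<open>k\<close>, all derivatives are collected in one function:
  \<open>D x [v\<^sub>1, \<dots>, v\<^sub>k]\<close> is the \<open>k\<close>-th derivative at \<open>x\<close>, applied to \<open>v\<^sub>1, \<dots>, v\<^sub>k\<close>.
  The last clause says that the \<open>k\<close>-th derivative, as a map from \<open>S\<close> into the bounded
  \<open>k\<close>-linear maps with the operator norm, has the \<open>(k+1)\<close>-st one as its Frechet derivative.
\<close>

definition smooth_on :: "'a::real_normed_vector set \<Rightarrow> ('a \<Rightarrow> 'b::real_normed_vector) \<Rightarrow> bool" where
  "smooth_on S f \<longleftrightarrow> (\<exists>D :: 'a \<Rightarrow> 'a list \<Rightarrow> 'b. \<forall>x\<in>S.
     D x [] = f x \<and>
     (\<forall>us ws. linear (\<lambda>v. D x (us @ v # ws))) \<and>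
     (\<forall>k. \<exists>K. \<forall>vs. length vs = k \<longrightarrow> norm (D x vs) \<le> K * prod_list (map norm vs)) \<and>
     (\<forall>k. \<forall>\<epsilon>>0. \<exists>\<delta>>0. \<forall>y\<in>S. dist y x < \<delta> \<longrightarrow> (\<forall>vs. length vs = k \<longrightarrow>
        norm (D y vs - D x vs - D x ((y - x) # vs)) \<le> \<epsilon> * norm (y - x) * prod_list (map norm vs))))"

definition gradient :: "('a::real_inner \<Rightarrow> real) \<Rightarrow> 'a \<Rightarrow> 'a" where
  "gradient \<eta> x = (THE g. GDERIV \<eta> x :> g)"

definition second_derivative ::
    "('a::real_normed_vector \<Rightarrow> 'b::real_normed_vector) \<Rightarrow> 'a \<Rightarrow> 'a \<Rightarrow> 'a \<Rightarrow> 'b" where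
  "second_derivative \<eta> u v w =
     blinfun_apply (frechet_derivative (\<lambda>x. Blinfun (frechet_derivative \<eta> (at x))) (at u) v) w"

text \<open>
  A Runge--Kutta method has coefficients \<open>A :: real^'s^'s\<close> and \<open>b, c :: real^'s\<close>, where the
  index type \<open>'s\<close> enumerates the stages.
\<close>

definition step_sizes :: "real^'s \<Rightarrow> real \<Rightarrow> real \<Rightarrow> real set" where
  "step_sizes c T t = {h. 0 < h \<and> (\<forall>i. t + c $ i * h \<in> {0..T})}"

definition stage_equations ::
    "real^'s^'s \<Rightarrow> real^'s \<Rightarrow> (real \<Rightarrow> 'a \<Rightarrow> 'a::real_normed_vector) \<Rightarrow> real \<Rightarrow> 'a \<Rightarrow> real
      \<Rightarrow> ('s::finite \<Rightarrow> 'a) \<Rightarrow> bool" where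
  "stage_equations A c f t u h y \<longleftrightarrow>
     (\<forall>i. y i = u + h *\<^sub>R (\<Sum>j\<in>UNIV. A $ i $ j *\<^sub>R f (t + c $ j * h) (y j)))"

text \<open>
  \<open>y h i\<close> is the \<open>i\<close>-th stage value for step size \<open>h\<close>.  For implicit methods the stage
  equations need only be solvable for small \<open>h\<close>, and the condition that the stage values tend
  to \<open>u\<close> selects the solution; for explicit methods this condition holds automatically.
\<close>

definition stage_branch ::
    "real^'s^'s \<Rightarrow> real^'s \<Rightarrow> (real \<Rightarrow> 'a \<Rightarrow> 'a::real_normed_vector) \<Rightarrow> real \<Rightarrow> real \<Rightarrow> 'a
      \<Rightarrow> (real \<Rightarrow> 's::finite \<Rightarrow> 'a) \<Rightarrow> bool" where
  "stage_branch A c f T t u y \<longleftrightarrow>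
     (\<forall>\<^sub>F h in at 0 within step_sizes c T t. stage_equations A c f t u h (y h)) \<and>
     (\<forall>i. ((\<lambda>h. y h i) \<longlongrightarrow> u) (at 0 within step_sizes c T t))"

definition relaxation_residual ::
    "real^'s \<Rightarrow> real^'s \<Rightarrow> ('a \<Rightarrow> real) \<Rightarrow> (real \<Rightarrow> 'a \<Rightarrow> 'a::real_inner) \<Rightarrow> real \<Rightarrow> 'a \<Rightarrow> real
      \<Rightarrow> ('s::finite \<Rightarrow> 'a) \<Rightarrow> real \<Rightarrow> real" where
  "relaxation_residual b c \<eta> f t u h y \<gamma> =
     \<eta> (u + (\<gamma> * h) *\<^sub>R (\<Sum>i\<in>UNIV. b $ i *\<^sub>R f (t + c $ i * h) (y i))) - \<eta> u
       - \<gamma> * h * (\<Sum>i\<in>UNIV. b $ i * (gradient \<eta> (y i) \<bullet> f (t + c $ i * h) (y i)))"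

end

theory Submission imports Defs begin

text \<open>
  With \<open>B = \<Sum> b\<^sub>i\<close>, \<open>P = \<Sum> b\<^sub>i c\<^sub>i\<close> and \<open>q = \<eta>''(u)(f\<^sub>0, f\<^sub>0)\<close>, Taylor expansion in the step size
  gives \<open>r(\<gamma>) / h\<^sup>2 \<longlongrightarrow> (\<gamma>\<^sup>2 B\<^sup>2 / 2 - \<gamma> P) q\<close> for every fixed \<open>\<gamma>\<close>: the first order terms
  cancel.  As \<open>0 < P < B\<^sup>2\<close>, the limit is negative at \<open>\<gamma> = P / B\<^sup>2\<close> and positive at \<open>\<gamma> = 2\<close>,
  so \<open>r\<close> has a root between these two points once \<open>h\<close> is small.
\<close>

section \<open>Gradients in Hilbert spaces\<close>

text \<open>Riesz representation by the direct method: a minimising sequence of \<open>J\<close> is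
  Cauchy by the parallelogram law, completeness supplies its limit \<open>g\<close>, and minimality
  of \<open>J\<close> at \<open>g\<close> along every line forces
  \<open>f x = x \<bullet> g\<close>.\<close>

lemma bounded_linear_inner_representation:
  fixes f :: "'a::{real_inner, complete_space} \<Rightarrow> real"
  assumes "bounded_linear f"
  shows "\<exists>g. \<forall>x. f x = x \<bullet> g"
proof -
  interpret bounded_linear f by fact
  \<comment> \<open>The representing vector is the minimiser of this functional.\<close>
  define J where "J x = x \<bullet> x / 2 - f x" for x
  \<comment> \<open>Parallelogram law: the linear part \<open>f\<close> cancels between the two
    points and their midpoint.\<close>
  have par: "J x + J y - 2 * J ((1/2) *\<^sub>R (x + y)) = (dist x y)\<^sup>2 / 4" for x y
    by (simp add: J_def dist_norm power2_norm_eq_inner inner_diff_left inner_diff_right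
        inner_add_left inner_add_right scaleR add inner_commute field_simps)
  obtain K where K: "\<And>x. norm (f x) \<le> norm x * K"
    using bounded by blast
  have lower: "- (K\<^sup>2 / 2) \<le> J x" for x
  proof -
    \<comment> \<open>Completing the square in
      \<open>J x \<ge> (norm x)\<^sup>2 / 2 - K * norm x\<close>.\<close>
    have "0 \<le> (norm x - K)\<^sup>2" by simp
    then show ?thesis
      using K[of x] by (simp add: J_def power2_diff flip: power2_norm_eq_inner)
  qed
  then have bdd: "bdd_below (range J)"
    by (intro bdd_belowI2)
  define m where "m = Inf (range J)"
  have m_le: "m \<le> J x" for x
    unfolding m_def using bdd by (intro cInf_lower) auto
  have "\<exists>x. J x < m + inverse (real (Suc n))" for n
  proof -
    have "Inf (range J) < m + inverse (real (Suc n))" by (simp add: m_def)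
    then show ?thesis using cInf_lessD[of "range J"] by blast
  qed
  then obtain X where X: "\<And>n. J (X n) < m + inverse (real (Suc n))" by metis
  have dist_X: "(dist (X k) (X n))\<^sup>2 \<le> 4 * (inverse (real (Suc k)) + inverse (real (Suc n)))" for k n
  proof -
    \<comment> \<open>In \<open>par\<close> the midpoint contributes at least \<open>2 * m\<close>,
      so only the two excesses over the infimum remain.\<close>
    have "(dist (X k) (X n))\<^sup>2 / 4 \<le> inverse (real (Suc k)) + inverse (real (Suc n))"
      using m_le[of "(1/2) *\<^sub>R (X k + X n)"] X[of k] X[of n]
      unfolding par[symmetric] by argo
    then show ?thesis by argo
  qed
  have "Cauchy X"
  proof (rule metric_CauchyI)
    fix e :: real assume "e > 0"
    \<comment> \<open>The 8 makes \<open>4 * (e\<^sup>2 / 8 + e\<^sup>2 / 8) = e\<^sup>2\<close> in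
      \<open>dist_X\<close>.\<close>
    then obtain N where N: "inverse (real (Suc N)) < e\<^sup>2 / 8"
      using reals_Archimedean[of "e\<^sup>2 / 8"] by auto
    have "dist (X k) (X n) < e" if "k \<ge> N" "n \<ge> N" for k n
    proof -
      have "inverse (real (Suc k)) \<le> inverse (real (Suc N))"
        "inverse (real (Suc n)) \<le> inverse (real (Suc N))"
        using that by (auto intro!: le_imp_inverse_le)
      then have "(dist (X k) (X n))\<^sup>2 < e\<^sup>2" using dist_X[of k n] N by argo
      then show ?thesis using \<open>e > 0\<close> by (simp add: power_less_imp_less_base)
    qed
    then show "\<exists>M. \<forall>k\<ge>M. \<forall>n\<ge>M. dist (X k) (X n) < e" by blast
  qed
  then obtain g where g: "X \<longlonglongrightarrow> g"
    using Cauchy_convergent convergent_def by blast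
  have "(\<lambda>n. J (X n)) \<longlonglongrightarrow> J g"
    unfolding J_def by (intro tendsto_intros tendsto g) simp
  moreover have "(\<lambda>n. m + inverse (real (Suc n))) \<longlonglongrightarrow> m + 0"
    by (intro tendsto_intros LIMSEQ_inverse_real_of_nat)
  ultimately have "J g \<le> m"
    using X by (intro LIMSEQ_le[of "\<lambda>n. J (X n)" "J g" "\<lambda>n. m + inverse (real (Suc n))"])
      (auto intro: less_imp_le)
  then have min: "J g \<le> J x" for x using m_le order_trans by blast
  have "f x = x \<bullet> g" for x
  proof (rule ccontr)
    define d where "d = f x - x \<bullet> g"
    assume "f x \<noteq> x \<bullet> g"
    then have "d \<noteq> 0" by (simp add: d_def)
    have "x \<noteq> 0" using \<open>d \<noteq> 0\<close> by (auto simp: d_def zero)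
    then have pos: "x \<bullet> x > 0" by simp
    \<comment> \<open>The minimiser of the quadratic
      \<open>t\<^sup>2 * (x \<bullet> x) / 2 - t * d\<close>, which is the change of
      \<open>J\<close> from \<open>g\<close> to \<open>g + t *\<^sub>R x\<close>.\<close>
    define t where "t = d / (x \<bullet> x)"
    have "J (g + t *\<^sub>R x) = J g + t\<^sup>2 * (x \<bullet> x) / 2 - t * d"
      by (simp add: J_def d_def scaleR add inner_add_left inner_add_right inner_commute
          power2_eq_square field_simps)
    also have "\<dots> = J g - d\<^sup>2 / (2 * (x \<bullet> x))"
      using pos by (simp add: t_def power2_eq_square field_simps)
    also have "\<dots> < J g" using pos \<open>d \<noteq> 0\<close> by simp
    finally show False using min[of "g + t *\<^sub>R x"] by linarith
  qed
  then show ?thesis by blast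
qed

text \<open>Since \<open>gradient\<close> is a definite description, both existence and uniqueness
  are due: existence is the Riesz representation of the derivative, and uniqueness follows by
  testing two candidates on their difference.\<close>

lemma gradient_inner:
  fixes \<eta> :: "'a::{real_inner, complete_space} \<Rightarrow> real"
  assumes "(\<eta> has_derivative \<eta>') (at x)"
  shows "gradient \<eta> x \<bullet> v = \<eta>' v"
proof -
  obtain g where g: "\<And>v. \<eta>' v = v \<bullet> g"
    using bounded_linear_inner_representation has_derivative_bounded_linear[OF assms] by blast
  then have "GDERIV \<eta> x :> g"
    using assms unfolding gderiv_def by (simp add: ext[of \<eta>' "\<lambda>v. v \<bullet> g"])
  moreover have "g' = g" if "GDERIV \<eta> x :> g'" for g'
  proof -
    have "\<eta>' = (\<lambda>v. v \<bullet> g')"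
      using has_derivative_unique[OF assms that[unfolded gderiv_def]] .
    then have "(g' - g) \<bullet> g' = (g' - g) \<bullet> g" using g by metis
    then have "(g' - g) \<bullet> (g' - g) = 0" by (simp add: inner_diff_right)
    then show ?thesis by simp
  qed
  ultimately have "gradient \<eta> x = g" unfolding gradient_def by (intro the_equality)
  then show ?thesis by (simp add: g inner_commute)
qed

section \<open>Smooth maps\<close>

text \<open>The order 0 remainder estimate and the bound on \<open>D x [v]\<close> give a Lipschitz
  estimate at each point. Working relative to \<open>S\<close> covers \<open>f\<close> at the
  boundary times 0 and \<open>T\<close>.\<close>

lemma smooth_on_continuous_on:
  assumes "smooth_on S f"
  shows "continuous_on S f"
  unfolding continuous_on_iff
proof (intro ballI allI impI)
  fix x and e :: real assume "x \<in> S" "e > 0"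
  obtain D where D: "\<forall>x\<in>S. D x [] = f x \<and>
     (\<forall>us ws. linear (\<lambda>v. D x (us @ v # ws))) \<and>
     (\<forall>k. \<exists>K. \<forall>vs. length vs = k \<longrightarrow> norm (D x vs) \<le> K * prod_list (map norm vs)) \<and>
     (\<forall>k. \<forall>\<epsilon>>0. \<exists>\<delta>>0. \<forall>y\<in>S. dist y x < \<delta> \<longrightarrow> (\<forall>vs. length vs = k \<longrightarrow>
        norm (D y vs - D x vs - D x ((y - x) # vs)) \<le> \<epsilon> * norm (y - x) * prod_list (map norm vs)))"
    using assms unfolding smooth_on_def by blast
  obtain K where "\<forall>vs. length vs = 1 \<longrightarrow> norm (D x vs) \<le> K * prod_list (map norm vs)"
    using D \<open>x \<in> S\<close> by blast
  then have K: "norm (D x [v]) \<le> K * norm v" for v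
    by (auto dest: spec[of _ "[v]"])
  obtain \<delta> where "\<delta> > 0" and \<delta>: "\<forall>y\<in>S. dist y x < \<delta> \<longrightarrow> (\<forall>vs. length vs = 0 \<longrightarrow>
        norm (D y vs - D x vs - D x ((y - x) # vs)) \<le> 1 * norm (y - x) * prod_list (map norm vs))"
    using D \<open>x \<in> S\<close> zero_less_one by blast
  \<comment> \<open>The estimate with \<epsilon> = 1 suffices. \<open>K\<close> may be negative,
    hence the absolute value.\<close>
  have main: "norm (f y - f x) \<le> (\<bar>K\<bar> + 1) * dist y x" if "y \<in> S" "dist y x < \<delta>" for y
  proof -
    have "norm (f y - f x - D x [y - x]) \<le> norm (y - x)"
      using \<delta> that D \<open>x \<in> S\<close> by force
    moreover have "norm (D x [y - x]) \<le> \<bar>K\<bar> * norm (y - x)"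
      by (rule order_trans[OF K]) (simp add: mult_right_mono)
    ultimately show ?thesis
      using norm_triangle_sub[of "f y - f x" "D x [y - x]"]
      by (simp add: dist_norm algebra_simps)
  qed
  show "\<exists>d>0. \<forall>x'\<in>S. dist x' x < d \<longrightarrow> dist (f x') (f x) < e"
  proof (intro exI[of _ "min \<delta> (e / (\<bar>K\<bar> + 1))"] conjI ballI impI)
    show "0 < min \<delta> (e / (\<bar>K\<bar> + 1))" using \<open>\<delta> > 0\<close> \<open>e > 0\<close> by simp
    fix y assume "y \<in> S" "dist y x < min \<delta> (e / (\<bar>K\<bar> + 1))"
    then have "(\<bar>K\<bar> + 1) * dist y x < e" by (simp add: field_simps)
    then show "dist (f y) (f x) < e"
      using main[of y] \<open>y \<in> S\<close> \<open>dist y x < _\<close> by (simp add: dist_norm)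
  qed
qed

text \<open>The list-indexed derivatives of orders 1 and 2 are curried into bounded operators, so
  that the usual calculus of \<open>has_derivative\<close> applies to them.\<close>

lemma smooth_on_UNIV_second_derivative:
  fixes f :: "'a::real_normed_vector \<Rightarrow> 'b::real_normed_vector"
  assumes "smooth_on UNIV f"
  obtains f' where "\<And>x. (f has_derivative blinfun_apply (f' x)) (at x)"
    and "\<And>x. \<exists>f''. (f' has_derivative f'') (at x)"
proof -
  obtain D where D0: "\<And>x. D x [] = f x"
    and lin: "\<And>x us ws. linear (\<lambda>v. D x (us @ v # ws))"
    and bdd: "\<And>x k. \<exists>K. \<forall>vs. length vs = k \<longrightarrow> norm (D x vs) \<le> K * prod_list (map norm vs)"
    and der: "\<And>x k \<epsilon>. \<epsilon> > 0 \<Longrightarrow> \<exists>\<delta>>0. \<forall>y. dist y x < \<delta> \<longrightarrow> (\<forall>vs. length vs = k \<longrightarrow>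
        norm (D y vs - D x vs - D x ((y - x) # vs)) \<le> \<epsilon> * norm (y - x) * prod_list (map norm vs))"
    using assms unfolding smooth_on_def by (simp, metis)
  have bl1: "bounded_linear (\<lambda>v. D x [v])" for x
  proof -
    obtain K where "\<forall>vs. length vs = 1 \<longrightarrow> norm (D x vs) \<le> K * prod_list (map norm vs)"
      using bdd by blast
    then have "norm (D x [v]) \<le> norm v * K" for v
      by (auto dest: spec[of _ "[v]"] simp: mult.commute)
    then show ?thesis
      using lin[of x "[]" "[]"] unfolding bounded_linear_def bounded_linear_axioms_def
      by auto
  qed
  define f' where "f' x = Blinfun (\<lambda>v. D x [v])" for x
  have f': "blinfun_apply (f' x) v = D x [v]" for x v
    by (simp add: f'_def bounded_linear_Blinfun_apply bl1)
  have "(f has_derivative blinfun_apply (f' x)) (at x)" for x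
    unfolding has_derivative_at_alt
  proof (intro conjI allI impI blinfun.bounded_linear_right)
    fix e :: real assume "e > 0"
    then show "\<exists>d>0. \<forall>y. norm (y - x) < d \<longrightarrow> norm (f y - f x - f' x (y - x)) \<le> e * norm (y - x)"
      using der[of e x 0] by (simp add: D0 f' dist_norm)
  qed
  moreover have "\<exists>f''. (f' has_derivative f'') (at x)" for x
  proof -
    obtain K0 where "\<forall>vs. length vs = 2 \<longrightarrow> norm (D x vs) \<le> K0 * prod_list (map norm vs)"
      using bdd by blast
    then have "norm (D x [v, w]) \<le> K0 * (norm v * norm w)" for v w
      by (auto dest: spec[of _ "[v, w]"])
    then have K: "norm (D x [v, w]) \<le> \<bar>K0\<bar> * norm v * norm w" for v w
      by (smt (verit, best) mult.assoc mult_right_mono norm_ge_zero zero_le_mult_iff)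
    \<comment> \<open>The first list entry is the direction of the newer differentiation, so
      \<open>v\<close> becomes the argument of \<open>f''\<close> and \<open>w\<close> that of the
      resulting operator. \<open>lin\<close> gives linearity in \<open>w\<close> with prefix
      \<open>[v]\<close>, and in \<open>v\<close> with suffix \<open>[w]\<close>.\<close>
    have bl2: "bounded_linear (\<lambda>w. D x [v, w])" for v
      using lin[of x "[v]" "[]"] K[of v]
      unfolding bounded_linear_def bounded_linear_axioms_def
      by (auto intro!: exI[of _ "\<bar>K0\<bar> * norm v"] simp: mult.commute)
    define f'' where "f'' v = Blinfun (\<lambda>w. D x [v, w])" for v
    have f'': "blinfun_apply (f'' v) w = D x [v, w]" for v w
      by (simp add: f''_def bounded_linear_Blinfun_apply bl2)
    have lin2: "linear (\<lambda>v. D x [v, w])" for w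
      using lin[of x "[]" "[w]"] by simp
    have "bounded_linear f''"
    proof (rule bounded_linear_intro[where K = "\<bar>K0\<bar>"])
      show "f'' (v + v') = f'' v + f'' v'" for v v'
        by (rule blinfun_eqI) (simp add: f'' blinfun.add_left linear_add[OF lin2])
      show "f'' (r *\<^sub>R v) = r *\<^sub>R f'' v" for r v
        by (rule blinfun_eqI) (simp add: f'' blinfun.scaleR_left linear_cmul[OF lin2])
      show "norm (f'' v) \<le> norm v * \<bar>K0\<bar>" for v
        using K[of v] by (intro norm_blinfun_bound) (auto simp: f'' mult.commute)
    qed
    moreover have "\<exists>d>0. \<forall>y. norm (y - x) < d \<longrightarrow>
        norm (f' y - f' x - f'' (y - x)) \<le> e * norm (y - x)" if "e > 0" for e
    proof -
      \<comment> \<open>One radius \<open>d\<close> serves all lists of length 1, which turns the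
        pointwise remainder estimate into one in operator norm.\<close>
      obtain d where "d > 0" and d: "\<And>y vs. dist y x < d \<Longrightarrow> length vs = 1 \<Longrightarrow>
          norm (D y vs - D x vs - D x ((y - x) # vs)) \<le> e * norm (y - x) * prod_list (map norm vs)"
        using der[OF \<open>e > 0\<close>, of x 1] by blast
      have "norm (f' y - f' x - f'' (y - x)) \<le> e * norm (y - x)" if "norm (y - x) < d" for y
      proof (rule norm_blinfun_bound)
        show "0 \<le> e * norm (y - x)" using \<open>e > 0\<close> by simp
        show "norm ((f' y - f' x - f'' (y - x)) v) \<le> e * norm (y - x) * norm v" for v
          using d[of y "[v]"] that by (simp add: dist_norm blinfun.diff_left f' f'')
      qed
      then show ?thesis using \<open>d > 0\<close> by blast
    qed
    ultimately show ?thesis unfolding has_derivative_at_alt by blast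
  qed
  ultimately show thesis by (rule that)
qed

text \<open>Uniqueness of Frechet derivatives identifies the operators chosen inside
  \<open>second_derivative\<close> with the given ones.\<close>

lemma second_derivative_eq:
  assumes "\<And>x. (f has_derivative blinfun_apply (f' x)) (at x)"
    and "(f' has_derivative f'') (at u)"
  shows "second_derivative f u v w = blinfun_apply (f'' v) w"
proof -
  have "(\<lambda>x. Blinfun (frechet_derivative f (at x))) = f'"
    by (simp add: frechet_derivative_at[OF assms(1), symmetric] blinfun_apply_inverse)
  then show ?thesis
    by (simp add: second_derivative_def frechet_derivative_at[OF assms(2), symmetric])
qed

text \<open>The mean value theorem on the segment from \<open>u\<close> to \<open>u + v\<close>,
  applied to \<open>f\<close> minus its quadratic part, reduces the claim to the first order
  remainder of \<open>f'\<close> at \<open>u\<close>.\<close>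

lemma second_order_Taylor_Peano:
  fixes f :: "'a::real_normed_vector \<Rightarrow> real"
  assumes f': "\<And>x. (f has_derivative blinfun_apply (f' x)) (at x)"
    and f'': "(f' has_derivative f'') (at u)"
  shows "((\<lambda>v. (f (u + v) - f u - f' u v - f'' v v / 2) / (norm v)\<^sup>2) \<longlongrightarrow> 0) (at 0)"
proof (rule LIM_I)
  fix e :: real assume "e > 0"
  then obtain d where "d > 0" and d: "\<And>y. norm (y - u) < d \<Longrightarrow>
      norm (f' y - f' u - f'' (y - u)) \<le> e / 2 * norm (y - u)"
    using f'' unfolding has_derivative_at_alt by (metis half_gt_zero)
  interpret bounded_linear f'' using f'' by (rule has_derivative_bounded_linear)
  have "\<bar>f (u + v) - f u - f' u v - f'' v v / 2\<bar> \<le> e / 2 * (norm v)\<^sup>2" if "norm v < d" for v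
  proof -
    \<comment> \<open>\<open>g 1 - g 0\<close> is the Taylor remainder up to the factor 1, and the
      term in \<open>s\<^sup>2\<close> has derivative \<open>f'' (s *\<^sub>R v) v\<close>.\<close>
    define g where "g s = f (u + s *\<^sub>R v) - s * f' u v - s\<^sup>2 * (f'' v v / 2)" for s :: real
    have g': "(g has_real_derivative (f' (u + s *\<^sub>R v) - f' u - f'' (s *\<^sub>R v)) v) (at s)" for s
    proof -
      have "((\<lambda>s. f (u + s *\<^sub>R v)) has_derivative (\<lambda>t. f' (u + s *\<^sub>R v) (t *\<^sub>R v))) (at s)"
        by (rule has_derivative_compose[OF _ f']) (auto intro!: derivative_eq_intros)
      then have "((\<lambda>s. f (u + s *\<^sub>R v)) has_real_derivative f' (u + s *\<^sub>R v) v) (at s)"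
        by (simp add: has_field_derivative_def blinfun.scaleR_right mult_commute_abs)
      then show ?thesis
        unfolding g_def
        by (auto intro!: derivative_eq_intros
            simp: blinfun.diff_left scaleR blinfun.scaleR_left)
    qed
    obtain z where z: "0 < z" "z < 1"
      and gz: "g 1 - g 0 = (1 - 0) * (f' (u + z *\<^sub>R v) - f' u - f'' (z *\<^sub>R v)) v"
      using MVT2[of 0 1 g, OF _ g'] by auto
    have zv: "norm (z *\<^sub>R v) \<le> norm v" using z by (simp add: mult_left_le_one_le)
    have "norm (f' (u + z *\<^sub>R v) - f' u - f'' (z *\<^sub>R v)) \<le> e / 2 * norm (z *\<^sub>R v)"
      using d[of "u + z *\<^sub>R v"] zv that by simp
    also have "\<dots> \<le> e / 2 * norm v" using zv \<open>e > 0\<close> by (intro mult_left_mono) auto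
    finally have "norm ((f' (u + z *\<^sub>R v) - f' u - f'' (z *\<^sub>R v)) v) \<le> e / 2 * norm v * norm v"
      by (rule order_trans[OF norm_blinfun mult_right_mono]) simp
    then show ?thesis
      using gz by (simp add: g_def power2_eq_square algebra_simps)
  qed
  \<comment> \<open>The spare factor 1/2 yields the strict inequality that the limit
    demands.\<close>
  moreover have "e / 2 * (norm v)\<^sup>2 < e * (norm v)\<^sup>2" if "v \<noteq> 0" for v :: 'a
    using that \<open>e > 0\<close> by simp
  ultimately show "\<exists>s>0. \<forall>v. v \<noteq> 0 \<and> norm (v - 0) < s \<longrightarrow>
      norm ((f (u + v) - f u - f' u v - f'' v v / 2) / (norm v)\<^sup>2 - 0) < e"
    using \<open>d > 0\<close>
    by (intro exI[of _ d]) (fastforce simp: pos_divide_less_eq intro: le_less_trans)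
qed

section \<open>The residual for small step sizes\<close>

text \<open>Expanding \<open>\<eta>\<close> at the end point and its gradient at the stages around
  \<open>u\<close> gives equal first order terms, so the residual is of order
  \<open>h\<^sup>2\<close>. Of the stages only \<open>y h i = u + h * d $ i * w + o(h)\<close>
  enters; the stage equations supply this with \<open>d = c\<close>.\<close>

lemma relaxation_residual_tendsto:
  fixes \<eta> :: "'a::{real_inner, complete_space} \<Rightarrow> real"
    and b c :: "real^'s"
  assumes \<eta>: "smooth_on UNIV \<eta>"
    and S: "S \<subseteq> {0<..}"
    and y: "\<And>i. ((\<lambda>h. (1 / h) *\<^sub>R (y h i - u)) \<longlongrightarrow> d $ i *\<^sub>R w) (at 0 within S)"
    and f: "\<And>i. ((\<lambda>h. f (t + c $ i * h) (y h i)) \<longlongrightarrow> w) (at 0 within S)"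
  shows "((\<lambda>h. relaxation_residual b c \<eta> f t u h (y h) \<gamma> / h\<^sup>2) \<longlongrightarrow>
      (\<gamma>\<^sup>2 * (\<Sum>i\<in>UNIV. b $ i)\<^sup>2 / 2 - \<gamma> * (\<Sum>i\<in>UNIV. b $ i * d $ i)) * second_derivative \<eta> u w w)
      (at 0 within S)"
proof -
  obtain \<eta>' where \<eta>': "\<And>x. (\<eta> has_derivative blinfun_apply (\<eta>' x)) (at x)"
    and "\<And>x. \<exists>\<eta>''. (\<eta>' has_derivative \<eta>'') (at x)"
    by (rule smooth_on_UNIV_second_derivative[OF \<eta>]) (rule that)
  then obtain \<eta>'' where \<eta>'': "(\<eta>' has_derivative \<eta>'') (at u)" by blast
  interpret H: bounded_linear \<eta>'' using \<eta>'' by (rule has_derivative_bounded_linear)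
  define F where "F h = (\<Sum>i\<in>UNIV. b $ i *\<^sub>R f (t + c $ i * h) (y h i))" for h
  define B where "B = (\<Sum>i\<in>UNIV. b $ i)"
  define Y where "Y h i = (1 / h) *\<^sub>R (y h i - u)" for h i
  \<comment> \<open>Relative Taylor remainders; \<open>x / 0 = 0\<close> gives them the value \<open>0\<close> at \<open>0\<close>, hence continuity.\<close>
  define \<rho> where "\<rho> v = (\<eta> (u + v) - \<eta> u - \<eta>' u v - \<eta>'' v v / 2) / (norm v)\<^sup>2" for v
  define \<sigma> where "\<sigma> v = (1 / norm v) *\<^sub>R (\<eta>' (u + v) - \<eta>' u - \<eta>'' v)" for v
  have "(\<rho> \<longlongrightarrow> 0) (at 0)"
    using second_order_Taylor_Peano[OF \<eta>' \<eta>''] by (simp add: \<rho>_def[abs_def])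
  moreover have "(\<sigma> \<longlongrightarrow> 0) (at 0)"
  proof -
    have "((\<lambda>v. norm (\<sigma> v)) \<longlongrightarrow> 0) (at 0)"
      using \<eta>'' unfolding has_derivative_at by (simp add: \<sigma>_def)
    then show ?thesis
      by (rule tendsto_norm_zero_cancel)
  qed
  \<comment> \<open>Full neighbourhoods of 0 are required because the arguments inserted later,
    multiples of \<open>F h\<close> and \<open>Y h i\<close>, may vanish.\<close>
  ultimately have rem: "(\<rho> \<longlongrightarrow> 0) (nhds 0)" "(\<sigma> \<longlongrightarrow> 0) (nhds 0)"
    by (simp_all add: tendsto_nhds_iff \<rho>_def \<sigma>_def)
  have \<rho>: "\<eta> (u + v) = \<eta> u + \<eta>' u v + \<eta>'' v v / 2 + \<rho> v * (norm v)\<^sup>2" for v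
    by (cases "v = 0") (simp_all add: \<rho>_def H.zero)
  have \<sigma>: "\<eta>' (u + v) = \<eta>' u + \<eta>'' v + norm v *\<^sub>R \<sigma> v" for v
    by (cases "v = 0") (simp_all add: \<sigma>_def H.zero)
  have F: "(F \<longlongrightarrow> B *\<^sub>R w) (at 0 within S)"
    unfolding F_def[abs_def] B_def scaleR_sum_left by (intro tendsto_intros f)
  have Y: "((\<lambda>h. Y h i) \<longlongrightarrow> d $ i *\<^sub>R w) (at 0 within S)" for i
    using y by (simp add: Y_def)
  \<comment> \<open>The residual divided by \<open>h\<^sup>2\<close> after cancellation of the first
    order terms; every ingredient converges, so the limit can be taken termwise.\<close>
  define G where "G h = \<gamma>\<^sup>2 * (\<eta>'' (F h) (F h) / 2 + \<rho> ((\<gamma> * h) *\<^sub>R F h) * (norm (F h))\<^sup>2)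
      - \<gamma> * (\<Sum>i\<in>UNIV. b $ i * ((\<eta>'' (Y h i) + norm (Y h i) *\<^sub>R \<sigma> (h *\<^sub>R Y h i))
          (f (t + c $ i * h) (y h i))))" for h
  \<comment> \<open>The limit is stated in the unsimplified shape that the termwise rules produce
    and is evaluated afterwards.\<close>
  have "(G \<longlongrightarrow> \<gamma>\<^sup>2 * (\<eta>'' (B *\<^sub>R w) (B *\<^sub>R w) / 2 + 0 * (norm (B *\<^sub>R w))\<^sup>2)
      - \<gamma> * (\<Sum>i\<in>UNIV. b $ i * ((\<eta>'' (d $ i *\<^sub>R w) + norm (d $ i *\<^sub>R w) *\<^sub>R 0) w)))
      (at 0 within S)"
    unfolding G_def[abs_def]
  proof (intro tendsto_intros H.tendsto F Y f)
    have "((\<lambda>h. (\<gamma> * h) *\<^sub>R F h) \<longlongrightarrow> (\<gamma> * 0) *\<^sub>R (B *\<^sub>R w)) (at 0 within S)"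
      by (intro tendsto_intros F)
    then show "((\<lambda>h. \<rho> ((\<gamma> * h) *\<^sub>R F h)) \<longlongrightarrow> 0) (at 0 within S)"
      using filterlim_compose[OF rem(1)] by simp
    show "(2::real) \<noteq> 0" by simp
    show "((\<lambda>h. \<sigma> (h *\<^sub>R Y h i)) \<longlongrightarrow> 0) (at 0 within S)" for i
    proof -
      have "((\<lambda>h. h *\<^sub>R Y h i) \<longlongrightarrow> 0 *\<^sub>R (d $ i *\<^sub>R w)) (at 0 within S)"
        by (intro tendsto_intros Y)
      then show ?thesis using filterlim_compose[OF rem(2)] by simp
    qed
  qed
  also have "\<gamma>\<^sup>2 * (\<eta>'' (B *\<^sub>R w) (B *\<^sub>R w) / 2 + 0 * (norm (B *\<^sub>R w))\<^sup>2)
      - \<gamma> * (\<Sum>i\<in>UNIV. b $ i * ((\<eta>'' (d $ i *\<^sub>R w) + norm (d $ i *\<^sub>R w) *\<^sub>R 0) w))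
      = (\<gamma>\<^sup>2 * B\<^sup>2 / 2 - \<gamma> * (\<Sum>i\<in>UNIV. b $ i * d $ i)) * second_derivative \<eta> u w w"
  proof -
    have "(\<Sum>i\<in>UNIV. b $ i * ((\<eta>'' (d $ i *\<^sub>R w) + norm (d $ i *\<^sub>R w) *\<^sub>R 0) w))
        = (\<Sum>i\<in>UNIV. b $ i * d $ i) * \<eta>'' w w"
      by (simp add: H.scaleR blinfun.scaleR_left sum_distrib_right mult.assoc)
    then show ?thesis
      by (simp add: second_derivative_eq[OF \<eta>' \<eta>''] H.scaleR blinfun.scaleR_left
          blinfun.scaleR_right power2_eq_square left_diff_distrib)
  qed
  finally have lim: "(G \<longlongrightarrow> \<dots>) (at 0 within S)" .
  have "G h = relaxation_residual b c \<eta> f t u h (y h) \<gamma> / h\<^sup>2" if "h > 0" for h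
  proof -
    define k where "k i = f (t + c $ i * h) (y h i)" for i
    have Fk: "F h = (\<Sum>i\<in>UNIV. b $ i *\<^sub>R k i)" by (simp add: F_def k_def)
    define E where "E i = (\<eta>'' (Y h i) + norm (Y h i) *\<^sub>R \<sigma> (h *\<^sub>R Y h i)) (k i)" for i
    have "y h i = u + h *\<^sub>R Y h i" for i using that by (simp add: Y_def)
    then have "\<eta>' (y h i) (k i) = \<eta>' u (k i) + h * E i" for i
      using that by (simp add: \<sigma> E_def H.scaleR blinfun.add_left blinfun.scaleR_left algebra_simps)
    \<comment> \<open>Weighted by \<open>b\<close>, the parts of the stage gradients taken at
      \<open>u\<close> add up to \<open>\<eta>' u (F h)\<close>, the same linear term as in the
      expansion of \<open>\<eta>\<close> along \<open>F h\<close>. Their cancellation leaves the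
      factor \<open>h\<^sup>2\<close>.\<close>
    then have "(\<Sum>i\<in>UNIV. b $ i * (gradient \<eta> (y h i) \<bullet> k i))
        = \<eta>' u (F h) + h * (\<Sum>i\<in>UNIV. b $ i * E i)"
      by (simp add: gradient_inner[OF \<eta>'] Fk blinfun.sum_right blinfun.scaleR_right
          sum.distrib sum_distrib_left algebra_simps)
    moreover have "\<eta> (u + (\<gamma> * h) *\<^sub>R F h) - \<eta> u = \<gamma> * h * \<eta>' u (F h)
        + (\<gamma> * h)\<^sup>2 * (\<eta>'' (F h) (F h) / 2 + \<rho> ((\<gamma> * h) *\<^sub>R F h) * (norm (F h))\<^sup>2)"
      by (subst \<rho>) (simp add: H.scaleR blinfun.scaleR_left blinfun.scaleR_right
          power_mult_distrib power2_eq_square algebra_simps)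
    ultimately have "relaxation_residual b c \<eta> f t u h (y h) \<gamma> = h\<^sup>2 * G h"
      unfolding relaxation_residual_def G_def k_def[symmetric] Fk[symmetric] E_def[symmetric]
      by (simp add: power2_eq_square algebra_simps)
    then show ?thesis using that by simp
  qed
  then have "\<forall>\<^sub>F h in at 0 within S. G h = relaxation_residual b c \<eta> f t u h (y h) \<gamma> / h\<^sup>2"
    using S by (auto simp: eventually_at_filter intro!: always_eventually)
  then show ?thesis
    using lim by (auto simp: B_def elim: Lim_transform_eventually)
qed

theorem theorem2p8:
  fixes \<eta> :: "'a::{real_inner, complete_space} \<Rightarrow> real"
    and f :: "real \<Rightarrow> 'a \<Rightarrow> 'a"
    and A :: "real^'s^'s"
    and b c :: "real^'s"
    and T t\<^sub>n :: real
    and u\<^sub>n :: 'a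
    and y :: "real \<Rightarrow> 's \<Rightarrow> 'a"
  assumes "smooth_on UNIV \<eta>"
    and "convex_on UNIV \<eta>"
    and "smooth_on ({0..T} \<times> UNIV) (\<lambda>(t, x). f t x)"
    and "A *v 1 = c"
    and "(\<Sum>i\<in>UNIV. \<Sum>j\<in>UNIV. b $ i * A $ i $ j) > 0"
    and "(\<Sum>i\<in>UNIV. \<Sum>j\<in>UNIV. b $ i * (A $ i $ j - b $ j)) < 0"
    and "t\<^sub>n \<in> {0..<T}"
    and "stage_branch A c f T t\<^sub>n u\<^sub>n y"
    and "second_derivative \<eta> u\<^sub>n (f t\<^sub>n u\<^sub>n) (f t\<^sub>n u\<^sub>n) > 0"
  shows "\<forall>\<^sub>F h in at 0 within step_sizes c T t\<^sub>n.
           \<exists>\<gamma>>0. relaxation_residual b c \<eta> f t\<^sub>n u\<^sub>n h (y h) \<gamma> = 0"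
proof -
  let ?S = "step_sizes c T t\<^sub>n" and ?w = "f t\<^sub>n u\<^sub>n"
  let ?F = "at 0 within ?S"
  let ?r = "\<lambda>h. relaxation_residual b c \<eta> f t\<^sub>n u\<^sub>n h (y h)"
  have pos: "?S \<subseteq> {0<..}" by (auto simp: step_sizes_def)
  have ev_S: "\<forall>\<^sub>F h in ?F. h \<in> ?S" by (simp add: eventually_at_filter)
  have ev_eq: "\<forall>\<^sub>F h in ?F. stage_equations A c f t\<^sub>n u\<^sub>n h (y h)"
    and y_lim: "((\<lambda>h. y h i) \<longlongrightarrow> u\<^sub>n) ?F" for i
    using assms(8) by (auto simp: stage_branch_def)
  have f_lim: "((\<lambda>h. f (t\<^sub>n + c $ i * h) (y h i)) \<longlongrightarrow> ?w) ?F" for i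
  proof -
    have "((\<lambda>h. (t\<^sub>n + c $ i * h, y h i)) \<longlongrightarrow> (t\<^sub>n + c $ i * 0, u\<^sub>n)) ?F"
      by (intro tendsto_intros y_lim)
    \<comment> \<open>Continuity of \<open>f\<close> is relative to times in \<open>{0..T}\<close>;
      membership of \<open>h\<close> in \<open>step_sizes\<close> keeps the stage times
      there.\<close>
    moreover have "\<forall>\<^sub>F h in ?F. (t\<^sub>n + c $ i * h, y h i) \<in> {0..T} \<times> UNIV"
      using ev_S by eventually_elim (auto simp: step_sizes_def)
    ultimately show ?thesis
      using continuous_on_tendsto_compose[OF smooth_on_continuous_on[OF assms(3)]] assms(7)
      by fastforce
  qed
  have c: "c $ i = (\<Sum>j\<in>UNIV. A $ i $ j)" for i
    using assms(4) by (auto simp: matrix_vector_mult_def)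
  have Y_lim: "((\<lambda>h. (1 / h) *\<^sub>R (y h i - u\<^sub>n)) \<longlongrightarrow> c $ i *\<^sub>R ?w) ?F" for i
  \<comment> \<open>By the stage equations the difference quotient is a sum over \<open>f\<close> at
    the stages, all of which tend to \<open>f t\<^sub>n u\<^sub>n\<close>; the row sums of
    \<open>A\<close> are the entries of \<open>c\<close>.\<close>
  proof (rule Lim_transform_eventually)
    show "((\<lambda>h. \<Sum>j\<in>UNIV. A $ i $ j *\<^sub>R f (t\<^sub>n + c $ j * h) (y h j)) \<longlongrightarrow> c $ i *\<^sub>R ?w) ?F"
      unfolding c[of i] scaleR_sum_left by (intro tendsto_intros f_lim)
    show "\<forall>\<^sub>F h in ?F. (\<Sum>j\<in>UNIV. A $ i $ j *\<^sub>R f (t\<^sub>n + c $ j * h) (y h j))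
        = (1 / h) *\<^sub>R (y h i - u\<^sub>n)"
      using ev_eq ev_S
    proof eventually_elim
      case (elim h)
      let ?X = "\<Sum>j\<in>UNIV. A $ i $ j *\<^sub>R f (t\<^sub>n + c $ j * h) (y h j)"
      have "y h i = u\<^sub>n + h *\<^sub>R ?X"
        using elim(1) unfolding stage_equations_def by (rule spec)
      then have "y h i - u\<^sub>n = (u\<^sub>n + h *\<^sub>R ?X) - u\<^sub>n"
        by (rule arg_cong)
      moreover have "h \<noteq> 0" using elim(2) pos by auto
      ultimately show ?case by simp
    qed
  qed
  define B where "B = (\<Sum>i\<in>UNIV. b $ i)"
  define P where "P = (\<Sum>i\<in>UNIV. b $ i * c $ i)"
  define q where "q = second_derivative \<eta> u\<^sub>n ?w ?w"
  have "q > 0" using assms(9) by (simp add: q_def)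
  \<comment> \<open>In these terms the two coefficient conditions read \<open>0 < P\<close> and
    \<open>P - B\<^sup>2 < 0\<close>.\<close>
  have "P = (\<Sum>i\<in>UNIV. \<Sum>j\<in>UNIV. b $ i * A $ i $ j)"
    by (simp add: P_def c sum_distrib_left)
  moreover have "B\<^sup>2 = (\<Sum>i\<in>UNIV. \<Sum>j\<in>UNIV. b $ i * b $ j)"
    by (simp add: B_def power2_eq_square sum_product)
  ultimately have P: "0 < P" "P < B\<^sup>2"
    using assms(5,6) by (simp_all add: sum_subtractf right_diff_distrib)
  have lim: "((\<lambda>h. ?r h \<gamma> / h\<^sup>2) \<longlongrightarrow> (\<gamma>\<^sup>2 * B\<^sup>2 / 2 - \<gamma> * P) * q) ?F" for \<gamma>
    unfolding B_def P_def q_def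
    by (rule relaxation_residual_tendsto[OF assms(1) pos Y_lim f_lim])
  \<comment> \<open>The minimiser of the limiting quadratic
    \<open>\<gamma>\<^sup>2 * B\<^sup>2 / 2 - \<gamma> * P\<close>, whose value there is strictly
    negative.\<close>
  define \<gamma>\<^sub>0 where "\<gamma>\<^sub>0 = P / B\<^sup>2"
  have \<gamma>\<^sub>0: "0 < \<gamma>\<^sub>0" "\<gamma>\<^sub>0 < 1" "\<gamma>\<^sub>0 * B\<^sup>2 = P"
    \<comment> \<open>Chaining the two inequalities gives \<open>0 < B\<^sup>2\<close>, so the
      division is legitimate; the deleted simp rule would rewrite this fact to
      \<open>B \<noteq> 0\<close>.\<close>
    using P order.strict_trans[OF P]
    by (simp_all add: \<gamma>\<^sub>0_def zero_less_divide_iff pos_divide_less_eq del: zero_less_power2)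
  have "\<gamma>\<^sub>0\<^sup>2 * B\<^sup>2 / 2 - \<gamma>\<^sub>0 * P = - (\<gamma>\<^sub>0 * P / 2)"
    unfolding \<gamma>\<^sub>0(3)[symmetric] by (simp add: power2_eq_square)
  then have neg: "(\<gamma>\<^sub>0\<^sup>2 * B\<^sup>2 / 2 - \<gamma>\<^sub>0 * P) * q < 0"
    using \<gamma>\<^sub>0(1) P(1) \<open>q > 0\<close> by simp
  \<comment> \<open>At \<gamma> = 2 the quadratic equals \<open>2 * (B\<^sup>2 - P)\<close>.\<close>
  have "0 < (2\<^sup>2 * B\<^sup>2 / 2 - 2 * P) * q"
    using P \<open>q > 0\<close> by simp
  then have "\<forall>\<^sub>F h in ?F. 0 < ?r h 2 / h\<^sup>2"
    using lim order_tendstoD(1) by blast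
  moreover have "\<forall>\<^sub>F h in ?F. ?r h \<gamma>\<^sub>0 / h\<^sup>2 < 0"
    using lim neg order_tendstoD(2) by blast
  ultimately show ?thesis
  proof eventually_elim
    case (elim h)
    then have "?r h \<gamma>\<^sub>0 \<le> 0" "0 \<le> ?r h 2"
      by (auto simp: divide_less_0_iff zero_less_divide_iff not_less)
    \<comment> \<open>For fixed \<open>h\<close> the stage values do not depend on \<gamma>, so
      continuity of \<open>\<eta>\<close> along a line is enough.\<close>
    moreover have "continuous_on {\<gamma>\<^sub>0..2} (?r h)"
      unfolding relaxation_residual_def
      by (intro continuous_intros
          continuous_on_compose2[OF smooth_on_continuous_on[OF assms(1)]]) auto
    ultimately obtain \<gamma> where "\<gamma>\<^sub>0 \<le> \<gamma>" "?r h \<gamma> = 0"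
      using IVT'[of "?r h" \<gamma>\<^sub>0 0 2] \<gamma>\<^sub>0(2) by auto
    then show ?case using \<gamma>\<^sub>0(1) by (intro exI[of _ \<gamma>]) auto
  qed
qed

end
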